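(* For every integer $k\ge 0$, the minimum number of crossings of a doubly-anchored open meander in the stratum $\mathcal{Q}(k,-1^{k+4})$ is $k+1$.
   Context: An open meander is a planar configuration consisting of a bi-infinite horizontal line and a simple arc intersecting the line transversally; crossings are the intersection points. In a doubly-anchored open meander both the horizontal line and the intersecting arc are anchored, i.e. both are regarded as compact arcs on the sphere whose endpoints (the anchors) are punctures: the intersecting arc is a compact simple arc with its endpoints off the line, and the line is replaced by a compact horizontal segment of it containing all crossings in its interior. In particular the regions above and below the line become connected to each other, and all intersections of the arc with the original line lie on the segment (the arc does not pass around the ends of the segment). Stratum of an anchored meander. View the configuration as a graph on the sphere whose vertices are the crossings (valence four) and the anchors (valence one). Each complementary region is treated as a polygon whose sides are the edges on its boundary, where an edge incident to a valence-one vertex is counted as a single side. A region that is a $(2k+4)$-gon is assigned order $k$ (bigons: $-1$, 4-gons: $0$, hexagons: $1$, ...). In addition each valence-one vertex contributes an order $-1$. The anchored meander lies in $\mathcal{Q}(k_1,\dots,k_n,-1^{p})$ (where $-1^p$ means $-1$ repeated $p$ times) if the resulting multiset of orders is $\{k_1,\dots,k_n,-1,\dots,-1\}$ ($p$ copies of $-1$), where additional regions of order $0$ beyond those listed are ignored; an order $0$ appearing in the list must be realised by a distinct 4-gon for each occurrence. *)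

theory Defs
  imports "HOL-Analysis.Analysis" "HOL-Library.Multiset"
begin

text \<open>
  The plane is the complex plane, and the sphere is its one-point compactification. All configurations
  below are compact subsets of the plane, so the complementary regions on the sphere are those in
  the plane, with the point at infinity added to the unbounded one; boundaries are not affected.
\<close>

definition horizontal_line :: "complex set" where
  "horizontal_line = {z. Im z = 0}"

definition crossings :: "(real \<Rightarrow> complex) \<Rightarrow> complex set" where
  "crossings \<gamma> = path_image \<gamma> \<inter> horizontal_line"

text \<open>
  Transversality in the topological sense: just before and just after the parameter \<open>t\<close> the curve is
  strictly on opposite sides of the line. Crossings of a path whose every meeting with the line is of
  this kind are isolated, hence finite in number by compactness.
\<close>

definition crosses_line_at :: "(real \<Rightarrow> complex) \<Rightarrow> real \<Rightarrow> bool" where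
  "crosses_line_at \<gamma> t \<longleftrightarrow>
     \<gamma> t \<in> horizontal_line \<and>
     (\<exists>\<epsilon>>0. \<forall>s. 0 < s \<and> s < \<epsilon> \<longrightarrow> Im (\<gamma> (t - s)) * Im (\<gamma> (t + s)) < 0)"

definition open_meander :: "(real \<Rightarrow> complex) \<Rightarrow> bool" where
  "open_meander \<gamma> \<longleftrightarrow>
     arc \<gamma> \<and> pathstart \<gamma> \<notin> horizontal_line \<and> pathfinish \<gamma> \<notin> horizontal_line \<and>
     (\<forall>t\<in>{0<..<1}. \<gamma> t \<in> horizontal_line \<longrightarrow> crosses_line_at \<gamma> t)"

text \<open>The line is cut down to the segment from \<open>a\<close> to \<open>b\<close>.\<close>

definition doubly_anchored_open_meander :: "(real \<Rightarrow> complex) \<Rightarrow> real \<Rightarrow> real \<Rightarrow> bool" where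
  "doubly_anchored_open_meander \<gamma> a b \<longleftrightarrow>
     open_meander \<gamma> \<and> a < b \<and> crossings \<gamma> \<subseteq> complex_of_real ` {a<..<b}"

definition meander_graph :: "(real \<Rightarrow> complex) \<Rightarrow> real \<Rightarrow> real \<Rightarrow> complex set" where
  "meander_graph \<gamma> a b = closed_segment (complex_of_real a) (complex_of_real b) \<union> path_image \<gamma>"

definition anchors :: "(real \<Rightarrow> complex) \<Rightarrow> real \<Rightarrow> real \<Rightarrow> complex set" where
  "anchors \<gamma> a b = {complex_of_real a, complex_of_real b, pathstart \<gamma>, pathfinish \<gamma>}"

text \<open>Edges are open, i.e. without their end vertices.\<close>

definition edges :: "(real \<Rightarrow> complex) \<Rightarrow> real \<Rightarrow> real \<Rightarrow> complex set set" where
  "edges \<gamma> a b = components (meander_graph \<gamma> a b - (crossings \<gamma> \<union> anchors \<gamma> a b))"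

definition regions :: "(real \<Rightarrow> complex) \<Rightarrow> real \<Rightarrow> real \<Rightarrow> complex set set" where
  "regions \<gamma> a b = components (- meander_graph \<gamma> a b)"

text \<open>
  Every edge on the boundary is counted once. For an edge at an anchor this is the convention that it
  is a single side although the region lies on both sides of it. No other edge has the same region
  on both sides: it joins two crossings, and these remain connected in the graph after its
  removal (along the segment if the edge lies on the arc, along the arc if it lies on the segment).
\<close>

definition num_sides :: "(real \<Rightarrow> complex) \<Rightarrow> real \<Rightarrow> real \<Rightarrow> complex set \<Rightarrow> nat" where
  "num_sides \<gamma> a b R = card {e \<in> edges \<gamma> a b. e \<subseteq> frontier R}"

text \<open>Rational-valued, so that having order \<open>k\<close> means exactly being a \<open>(2k+4)\<close>-gon.\<close>

definition region_order :: "(real \<Rightarrow> complex) \<Rightarrow> real \<Rightarrow> real \<Rightarrow> complex set \<Rightarrow> rat" where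
  "region_order \<gamma> a b R = of_nat (num_sides \<gamma> a b R) / 2 - 2"

definition meander_orders :: "(real \<Rightarrow> complex) \<Rightarrow> real \<Rightarrow> real \<Rightarrow> rat multiset" where
  "meander_orders \<gamma> a b =
     image_mset (region_order \<gamma> a b) (mset_set (regions \<gamma> a b)) +
     image_mset (\<lambda>_. -1) (mset_set (anchors \<gamma> a b))"

text \<open>
  \<open>\<kappa>\<close> is the full list of orders, the entries \<open>-1\<close> included; the \<open>z\<close> extra zeros are the \<open>4\<close>-gons beyond
  those listed.
\<close>

definition in_stratum :: "(real \<Rightarrow> complex) \<Rightarrow> real \<Rightarrow> real \<Rightarrow> int multiset \<Rightarrow> bool" where
  "in_stratum \<gamma> a b \<kappa> \<longleftrightarrow>
     (\<exists>z. meander_orders \<gamma> a b = image_mset of_int \<kappa> + replicate_mset z 0)"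

end

theory Submission
  imports Defs
begin

text \<open>
  A list of orders \<open>k, -1, \<dots>, -1\<close> with \<open>z\<close> additional zeros and four entries \<open>-1\<close> used up by the anchors
  leaves \<open>k + 1 + z\<close> regions, so it suffices that a configuration with \<open>n \<ge> 1\<close> crossings has at most \<open>n\<close>
  regions. The complement of the arc is connected. Remove the segment from it piece by piece from
  left to right: each of the \<open>n - 1\<close> pieces between consecutive crossings has two sides and hence splits at
  most one component in two, while the two dangling end pieces split nothing. Without crossings
  there are only two edges and no region has nonnegative order.

  The bound is attained by a sine curve over \<open>[-1/2, k + 1/2]\<close>: consecutive crossings bound \<open>k\<close>
  bigons, and the only other region has all \<open>2k + 4\<close> edges on its boundary.
\<close>

section \<open>The number of regions\<close>

text \<open>Away from \<open>T\<close>, the neighbourhood \<open>N\<close> lies in \<open>P\<close>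
  and \<open>Q\<close>, so a component of \<open>V - T\<close> that avoids both stays away from
  \<open>N\<close>. Such a component is untouched by the removal and remains a whole component of
  \<open>V\<close>. Only \<open>W\<close>, the component containing \<open>T\<close>, is lost, and
  what replaces it is among \<open>D\<close> and \<open>E\<close>, which may coincide.\<close>

lemma components_remove_collar:
  fixes V T N P Q :: "'a::real_normed_vector set"
  assumes "open (V - T)" "T \<subseteq> V" "T \<noteq> {}" "connected T"
    and N: "open N" "T \<subseteq> N" "N \<subseteq> T \<union> P \<union> Q"
    and P: "connected P" "P \<noteq> {}" "P \<subseteq> V - T"
    and Q: "connected Q" "Q \<noteq> {}" "Q \<subseteq> V - T"
  obtains W D E where "W \<in> components V" "P \<subseteq> D" "Q \<subseteq> E"
    "D \<in> components (V - T)" "E \<in> components (V - T)"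
    "components (V - T) \<subseteq> insert D (insert E (components V - {W}))"
proof -
  obtain W where W: "W \<in> components V" "T \<subseteq> W"
    using exists_component_superset[of T V] assms by blast
  obtain D where D: "D \<in> components (V - T)" "P \<subseteq> D"
    using exists_component_superset[of P "V - T"] P by blast
  obtain E where E: "E \<in> components (V - T)" "Q \<subseteq> E"
    using exists_component_superset[of Q "V - T"] Q by blast
  have "C \<in> components V - {W}" if C: "C \<in> components (V - T)" "C \<noteq> D" "C \<noteq> E" for C
  proof -
    have disj: "C \<inter> P = {}" "C \<inter> Q = {}"
      using C D E components_nonoverlap by blast+
    have CV: "C \<subseteq> V" "C \<noteq> {}" "C \<inter> T = {}"
      using in_components_subset[OF C(1)] in_components_nonempty[OF C(1)] by auto
    obtain C' where C': "C' \<in> components V" "C \<subseteq> C'"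
      using exists_component_superset[of C V] CV in_components_connected[OF C(1)] by blast
    \<comment> \<open>\<open>C\<close> and \<open>B\<close> are open, disjoint inside
      \<open>C'\<close> and cover \<open>C'\<close>. Connectedness of \<open>C'\<close> therefore
      forces \<open>C' = C\<close>.\<close>
    define B where "B = N \<union> (V - T - C)"
    have "V - T - C = \<Union> (components (V - T) - {C})"
      using C(1) in_components_unions_complement by blast
    then have "open B"
      unfolding B_def using N(1) open_components[OF assms(1)] by (metis DiffD1 open_Un open_Union)
    moreover have "open C"
      using C(1) assms(1) open_components by blast
    moreover have "C \<inter> B \<inter> C' = {}" "C' \<subseteq> C \<union> B"
      using N disj CV in_components_subset[OF C'(1)] unfolding B_def by blast+
    ultimately have "C \<inter> C' = {} \<or> B \<inter> C' = {}"
      using connectedD[OF in_components_connected[OF C'(1)], of C B] by blast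
    then have "C' = C"
      using C' CV \<open>C' \<subseteq> C \<union> B\<close> by blast
    then show ?thesis
      using C' W CV assms(3) by blast
  qed
  then have "components (V - T) \<subseteq> insert D (insert E (components V - {W}))"
    by blast
  then show ?thesis
    using that[OF W(1) D(2) E(2) D(1) E(1)] by blast
qed

text \<open>The one component \<open>W\<close> is traded for at most the two components
  \<open>D\<close> and \<open>E\<close>.\<close>

lemma card_components_remove_two_sided:
  fixes V T N P Q :: "'a::real_normed_vector set"
  assumes "open (V - T)" "T \<subseteq> V" "T \<noteq> {}" "connected T"
    "open N" "T \<subseteq> N" "N \<subseteq> T \<union> P \<union> Q"
    "connected P" "P \<noteq> {}" "P \<subseteq> V - T"
    "connected Q" "Q \<noteq> {}" "Q \<subseteq> V - T"
    and fin: "finite (components V)"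
  shows "finite (components (V - T)) \<and> card (components (V - T)) \<le> card (components V) + 1"
proof -
  obtain W D E where W: "W \<in> components V"
    and sub: "components (V - T) \<subseteq> insert D (insert E (components V - {W}))"
    using components_remove_collar[OF assms(1-13)] by metis
  have "card (components V - {W}) + 1 = card (components V)"
    using W fin by (metis Suc_eq_plus1 card_Suc_Diff1)
  moreover have "card (insert D (insert E (components V - {W}))) \<le> card (components V - {W}) + 2"
    using fin by (simp add: card_insert_if)
  ultimately show ?thesis
    using card_mono[OF _ sub] finite_subset[OF sub] fin by auto
qed

text \<open>Taking \<open>P\<close> for both sides makes \<open>D\<close> and \<open>E\<close>
  coincide, so \<open>W\<close> is traded for a single component.\<close>

lemma card_components_remove_one_sided:
  fixes V T N P :: "'a::real_normed_vector set"
  assumes "open (V - T)" "T \<subseteq> V" "T \<noteq> {}" "connected T"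
    "open N" "T \<subseteq> N" "N \<subseteq> T \<union> P"
    "connected P" "P \<noteq> {}" "P \<subseteq> V - T"
    and fin: "finite (components V)"
  shows "finite (components (V - T)) \<and> card (components (V - T)) \<le> card (components V)"
proof -
  have "N \<subseteq> T \<union> P \<union> P"
    using assms(7) by blast
  then obtain W D E where W: "W \<in> components V" and DE: "P \<subseteq> D" "P \<subseteq> E"
    "D \<in> components (V - T)" "E \<in> components (V - T)"
    and sub: "components (V - T) \<subseteq> insert D (insert E (components V - {W}))"
    using components_remove_collar[OF assms(1-6) _ assms(8-10) assms(8-10)] by metis
  have "D = E"
    using DE assms(9) components_nonoverlap by blast
  then have sub: "components (V - T) \<subseteq> insert D (components V - {W})"
    using sub by simp
  have "card (components V - {W}) + 1 = card (components V)"
    using W fin by (metis Suc_eq_plus1 card_Suc_Diff1)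
  then have "card (insert D (components V - {W})) \<le> card (components V)"
    by (metis Suc_eq_plus1 card_insert_le_m1 diff_Suc_1 order_refl zero_less_Suc)
  then show ?thesis
    using card_mono[OF _ sub] finite_subset[OF sub] fin by (meson finite_Diff finite_insert order_trans)
qed

section \<open>Coordinates around a piece of the real line\<close>

text \<open>The region over \<open>X\<close> in the coordinates \<open>(x, s)\<close>, where \<open>s\<close> is the height measured in multiples of \<open>f x\<close>.\<close>

definition band :: "(real \<Rightarrow> real) \<Rightarrow> real set \<Rightarrow> real set \<Rightarrow> complex set" where
  "band f X Y = (\<lambda>(x, s). Complex x (s * f x)) ` (X \<times> Y)"

lemma band_iff: "z \<in> band f X Y \<longleftrightarrow> (\<exists>x\<in>X. \<exists>s\<in>Y. z = Complex x (s * f x))"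
  unfolding band_def by auto

lemma mem_band:
  assumes "\<And>x. x \<in> X \<Longrightarrow> f x \<noteq> 0"
  shows "z \<in> band f X Y \<longleftrightarrow> Re z \<in> X \<and> Im z / f (Re z) \<in> Y"
proof
  assume r: "Re z \<in> X \<and> Im z / f (Re z) \<in> Y"
  then have "z = Complex (Re z) (Im z / f (Re z) * f (Re z))"
    using assms by (simp add: complex_eq_iff)
  then show "z \<in> band f X Y"
    using r unfolding band_iff by blast
qed (use assms in \<open>auto simp: band_iff\<close>)

lemma connected_band:
  assumes "continuous_on X f" "connected X" "connected Y"
  shows "connected (band f X Y)"
  unfolding band_def
proof (rule connected_continuous_image)
  show "continuous_on (X \<times> Y) (\<lambda>(x, s). Complex x (s * f x))"
    unfolding Complex_eq case_prod_unfold
    by (intro continuous_intros continuous_on_compose2[OF assms(1)]) auto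
  show "connected (X \<times> Y)"
    using assms by (intro connected_Times)
qed

lemma open_band:
  assumes "continuous_on X f" "\<And>x. x \<in> X \<Longrightarrow> f x \<noteq> 0" "open X" "open Y"
  shows "open (band f X Y)"
proof -
  have "band f X Y = Re -` X \<inter> (\<lambda>z. Im z / f (Re z)) -` Y"
    using mem_band[of X f _ Y] assms(2) by auto
  also have "open \<dots>"
  proof (rule continuous_open_preimage)
    show "continuous_on (Re -` X) (\<lambda>z. Im z / f (Re z))"
      using assms(2) by (intro continuous_intros continuous_on_compose2[OF assms(1)]) auto
    show "open (Re -` X)"
      using assms(3) by (intro open_vimage continuous_intros)
  qed (rule assms(4))
  finally show ?thesis .
qed

text \<open>The limit is taken in the vertical coordinate alone, over a fixed \<open>x\<close>. This
  later shows that an edge lies in the closure of a region next to it.\<close>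

lemma band_closure_subset: "band f X (closure Y) \<subseteq> closure (band f X Y)"
proof
  fix z assume "z \<in> band f X (closure Y)"
  then obtain x s where xs: "x \<in> X" "s \<in> closure Y" "z = Complex x (s * f x)"
    by (auto simp: band_iff)
  have "(\<lambda>s. Complex x (s * f x)) ` closure Y \<subseteq> closure (band f X Y)"
  proof (rule image_closure_subset)
    show "continuous_on (closure Y) (\<lambda>s. Complex x (s * f x))"
      unfolding Complex_eq by (intro continuous_intros)
    have "(\<lambda>s. Complex x (s * f x)) ` Y \<subseteq> band f X Y"
      using xs(1) by (auto simp: band_iff)
    then show "(\<lambda>s. Complex x (s * f x)) ` Y \<subseteq> closure (band f X Y)"
      using closure_subset by blast
  qed auto
  then show "z \<in> closure (band f X Y)"
    using xs by blast
qed

text \<open>The width of the strip is the distance to the complement of \<open>V\<close>, so that the strip stays inside \<open>V\<close>.\<close>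

abbreviation strip :: "complex set \<Rightarrow> real set \<Rightarrow> real set \<Rightarrow> complex set" where
  "strip V \<equiv> band (\<lambda>x. infdist (complex_of_real x) (- V))"

lemma of_real_in_strip: "x \<in> X \<Longrightarrow> 0 \<in> Y \<Longrightarrow> complex_of_real x \<in> strip V X Y"
  unfolding band_iff complex_of_real_def by force

lemma connected_strip:
  assumes "connected X" "connected Y"
  shows "connected (strip V X Y)"
  using assms by (intro connected_band continuous_intros)

text \<open>The condition \<open>V \<noteq> UNIV\<close> matters because \<open>infdist\<close> to
  the empty set is \<open>0\<close> by convention, which would collapse the strip onto the
  line.\<close>

lemma infdist_Compl_pos:
  fixes V :: "complex set"
  assumes "open V" "V \<noteq> UNIV" "z \<in> V"
  shows "infdist z (- V) > 0"
  using assms infdist_pos_not_in_closed[of "- V" z] by (auto simp: closed_def)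

text \<open>A point of the strip is closer to its foot on the real line than that foot is to the
  complement of \<open>V\<close>.\<close>

lemma strip_subset:
  assumes "open V" "V \<noteq> UNIV" "complex_of_real ` X \<subseteq> V"
  shows "strip V X {-1<..<1} \<subseteq> V"
proof
  fix z assume "z \<in> strip V X {-1<..<1}"
  then obtain x s where xs: "x \<in> X" "\<bar>s\<bar> < 1"
    and z: "z = Complex x (s * infdist (of_real x) (- V))"
    by (auto simp: band_iff abs_less_iff)
  have pos: "infdist (complex_of_real x) (- V) > 0"
    using assms xs by (intro infdist_Compl_pos) auto
  have "dist (of_real x) z = \<bar>s\<bar> * infdist (of_real x) (- V)"
    using pos by (simp add: z dist_norm cmod_def abs_mult)
  also have "\<dots> < infdist (of_real x) (- V)"
    using xs pos by simp
  finally show "z \<in> V"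
    using infdist_le[of z "- V" "of_real x"] by force
qed

lemma open_strip:
  assumes "open V" "V \<noteq> UNIV" "complex_of_real ` X \<subseteq> V" "open X"
  shows "open (strip V X {-1<..<1})"
proof (intro open_band continuous_intros)
  fix x assume "x \<in> X"
  then have "infdist (complex_of_real x) (- V) > 0"
    using assms by (intro infdist_Compl_pos) auto
  then show "infdist (complex_of_real x) (- V) \<noteq> 0"
    by simp
qed (use assms in auto)

lemma strip_Re_Im:
  assumes "open V" "V \<noteq> UNIV" "complex_of_real ` X \<subseteq> V" "z \<in> strip V X Y"
  obtains x s where "z = Complex x (Im z)" "x \<in> X" "s \<in> Y" "sgn (Im z) = sgn s"
proof -
  obtain x s where xs: "x \<in> X" "s \<in> Y"
    and z: "z = Complex x (s * infdist (of_real x) (- V))"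
    using assms(4) unfolding band_def by fastforce
  have "infdist (complex_of_real x) (- V) > 0"
    using assms xs by (intro infdist_Compl_pos) auto
  then show ?thesis
    using that xs z by (simp add: sgn_mult)
qed

section \<open>Cutting along pieces of the segment\<close>

text \<open>The strip over the open piece serves as the collar, and its upper and lower halves are
  the two sides.\<close>

lemma card_components_remove_edge:
  assumes V: "open V" "V \<noteq> UNIV" and J: "p < q" "complex_of_real ` {p<..<q} \<subseteq> V"
    and op: "open (V - complex_of_real ` {p<..<q})" and fin: "finite (components V)"
  shows "finite (components (V - complex_of_real ` {p<..<q})) \<and>
    card (components (V - complex_of_real ` {p<..<q})) \<le> card (components V) + 1"
proof -
  let ?X = "{p<..<q}"
  have ne: "?X \<noteq> {}" using J by simp
  have T1: "complex_of_real ` ?X \<noteq> {}" using ne by blast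
  have T2: "connected (complex_of_real ` ?X)"
    by (intro connected_continuous_image continuous_intros) auto
  have N1: "open (strip V ?X {-1<..<1})" by (intro open_strip V J) auto
  have N2: "complex_of_real ` ?X \<subseteq> strip V ?X {-1<..<1}"
    by (auto intro: of_real_in_strip)
  have N3: "strip V ?X {-1<..<1} \<subseteq> complex_of_real ` ?X \<union> strip V ?X {0<..<1} \<union> strip V ?X {-1<..<0}"
  proof
    fix z assume "z \<in> strip V ?X {-1<..<1}"
    then obtain x s where "x \<in> ?X" "-1 < s" "s < 1"
      and z: "z = Complex x (s * infdist (of_real x) (- V))"
      by (auto simp: band_iff)
    then show "z \<in> complex_of_real ` ?X \<union> strip V ?X {0<..<1} \<union> strip V ?X {-1<..<0}"
      by (cases s "0::real" rule: linorder_cases) (auto simp: band_iff complex_of_real_def)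
  qed
  have *: "connected (strip V ?X Y) \<and> strip V ?X Y \<noteq> {} \<and> strip V ?X Y \<subseteq> V - complex_of_real ` ?X"
    if "connected Y" "Y \<noteq> {}" "Y \<subseteq> {-1<..<1} - {0}" for Y
  proof (intro conjI)
    show "connected (strip V ?X Y)" using that by (intro connected_strip) auto
    show "strip V ?X Y \<noteq> {}" using that ne by (simp add: band_def)
    have "z \<notin> complex_of_real ` ?X" if "z \<in> strip V ?X Y" for z
      using strip_Re_Im[OF V J(2) that] \<open>Y \<subseteq> {-1<..<1} - {0}\<close>
      by (metis Diff_iff Im_complex_of_real imageE insertI1 sgn_0 sgn_0_0 subsetD)
    moreover have "strip V ?X Y \<subseteq> strip V ?X {-1<..<1}"
      using that by (force simp: band_iff)
    ultimately show "strip V ?X Y \<subseteq> V - complex_of_real ` ?X"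
      using strip_subset[OF V J(2)] by blast
  qed
  have sides: "{0<..<1} \<subseteq> {-1<..<1} - {0::real}" "{-1<..<0} \<subseteq> {-1<..<1} - {0::real}"
    by auto
  have U: "connected (strip V ?X {0<..<1})" "strip V ?X {0<..<1} \<noteq> {}"
    "strip V ?X {0<..<1} \<subseteq> V - complex_of_real ` ?X"
    using *[OF _ _ sides(1)] by auto
  have L: "connected (strip V ?X {-1<..<0})" "strip V ?X {-1<..<0} \<noteq> {}"
    "strip V ?X {-1<..<0} \<subseteq> V - complex_of_real ` ?X"
    using *[OF _ _ sides(2)] by auto
  show ?thesis
    by (rule card_components_remove_two_sided[OF op J(2) T1 T2 N1 N2 N3 U L fin])
qed

text \<open>The part of the strip over \<open>{p<..<q} - I\<close> joins the two sides of the removed piece.\<close>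

lemma card_components_remove_dangling:
  assumes V: "open V" "V \<noteq> UNIV" and J: "complex_of_real ` {p<..<q} \<subseteq> V"
    and I: "I \<subseteq> {p<..<q}" "connected I" "I \<noteq> {}"
    and M: "connected ({p<..<q} - I)" "{p<..<q} - I \<noteq> {}"
    and op: "open (V - complex_of_real ` I)" and fin: "finite (components V)"
  shows "finite (components (V - complex_of_real ` I)) \<and>
    card (components (V - complex_of_real ` I)) \<le> card (components V)"
proof -
  let ?X = "{p<..<q}"
  define P where "P = strip V ?X {0<..<1} \<union> strip V (?X - I) {-1<..<1} \<union> strip V ?X {-1<..<0}"
  have ne: "?X \<noteq> {}" using I by blast
  have T1: "complex_of_real ` I \<noteq> {}" using I by blast
  have T2: "connected (complex_of_real ` I)"
    using I by (intro connected_continuous_image continuous_intros) auto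
  have N1: "open (strip V ?X {-1<..<1})" by (intro open_strip V J) auto
  have N2: "complex_of_real ` I \<subseteq> strip V ?X {-1<..<1}"
    using I by (auto intro!: of_real_in_strip)
  have N3: "strip V ?X {-1<..<1} \<subseteq> complex_of_real ` I \<union> P"
  proof
    fix z assume "z \<in> strip V ?X {-1<..<1}"
    then obtain x s where "x \<in> ?X" "-1 < s" "s < 1"
      and z: "z = Complex x (s * infdist (of_real x) (- V))"
      by (auto simp: band_iff)
    then show "z \<in> complex_of_real ` I \<union> P"
      unfolding P_def Un_iff band_iff
      by (cases s "0::real" rule: linorder_cases; cases "x \<in> I")
        (auto simp: complex_of_real_def intro: bexI[of _ x])
  qed
  have mem: "Complex x (s * infdist (of_real x) (- V)) \<in> strip V X Y" if "x \<in> X" "s \<in> Y" for x s X Y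
    using that unfolding band_def by force
  \<comment> \<open>Over \<open>m\<close>, the points at relative heights \<open>1/2\<close> and
    \<open>-1/2\<close> lie in the middle strip and in the upper and lower half respectively, so the
    three parts of \<open>P\<close> form a chain of overlapping connected sets.\<close>
  obtain m where m: "m \<in> ?X - I" using M by blast
  have "Complex m (1/2 * infdist (of_real m) (- V)) \<in> strip V ?X {0<..<1} \<inter> strip V (?X - I) {-1<..<1}"
    using m by (intro IntI mem) auto
  moreover have "Complex m (-1/2 * infdist (of_real m) (- V)) \<in> strip V (?X - I) {-1<..<1} \<inter> strip V ?X {-1<..<0}"
    using m by (intro IntI mem) auto
  ultimately have P1: "connected P"
    unfolding P_def using M
    by (intro connected_Un connected_strip) auto
  have P2: "P \<noteq> {}" using ne by (simp add: P_def band_def)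
  have "P \<subseteq> strip V ?X {-1<..<1}"
    unfolding P_def by (auto simp: band_def)
  moreover have "P \<inter> complex_of_real ` I = {}"
  proof -
    have "z \<notin> complex_of_real ` I" if "z \<in> strip V ?X Y" "0 \<notin> Y" for z Y
      using strip_Re_Im[OF V J that(1)] that(2)
      by (metis Im_complex_of_real imageE sgn_0 sgn_0_0)
    moreover have "z \<notin> complex_of_real ` I" if "z \<in> strip V (?X - I) Y" for z Y
      using that unfolding band_def by (auto simp: complex_eq_iff)
    ultimately show ?thesis
      unfolding P_def by fastforce
  qed
  ultimately have P3: "P \<subseteq> V - complex_of_real ` I"
    using strip_subset[OF V J] by blast
  have IV: "complex_of_real ` I \<subseteq> V"
    using I J by blast
  show ?thesis
    by (rule card_components_remove_one_sided[OF op IV T1 T2 N1 N2 N3 P1 P2 P3 fin])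
qed

text \<open>The points of \<open>C\<close> divide the segment into pieces, which are removed from
  left to right. Stopping at points of \<open>C\<close> is harmless since these belong to
  \<open>A\<close> already.\<close>

lemma card_components_Compl_Un_segment:
  fixes A :: "complex set" and a b :: real
  defines "C \<equiv> {x. complex_of_real x \<in> A \<and> a \<le> x \<and> x \<le> b}"
  assumes A: "closed A" "connected (- A)" and ab: "a \<le> b"
    and C: "finite C" "C \<noteq> {}" "C \<subseteq> {a<..<b}"
  shows "finite (components (- (A \<union> complex_of_real ` {a..b}))) \<and>
    card (components (- (A \<union> complex_of_real ` {a..b}))) \<le> card C"
proof -
  have op: "open (- (A \<union> complex_of_real ` {x..y}))" for x y
    by (intro open_Compl closed_Un A compact_imp_closed compact_continuous_image continuous_intros) auto
  have ne: "- (A \<union> X) \<noteq> UNIV" "- A \<noteq> UNIV" for X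
    using C(2) by (auto simp: C_def)
  \<comment> \<open>Since \<open>a\<close> and \<open>b\<close> are not in \<open>A\<close>, there
    is free room just beyond both ends; it supplies the part of the line that joins the two sides of
    a dangling piece.\<close>
  have gap: "\<exists>e>0. \<forall>x. \<bar>x - y\<bar> < e \<longrightarrow> complex_of_real x \<notin> A" if "y \<in> {a, b}" for y
  proof -
    have "complex_of_real y \<in> - A"
      using that C(3) ab unfolding C_def by auto
    then obtain e where e: "e > 0" "ball (complex_of_real y) e \<subseteq> - A"
      using A(1) by (metis open_Compl open_contains_ball_eq)
    have "complex_of_real x \<notin> A" if "\<bar>x - y\<bar> < e" for x
    proof -
      have "dist (complex_of_real y) (complex_of_real x) < e"
        using that by (simp add: dist_of_real dist_real_def abs_minus_commute)
      then show ?thesis using e(2) by (auto simp del: dist_of_real)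
    qed
    then show ?thesis using e(1) by blast
  qed
  \<comment> \<open>The invariant of the sweep: once the segment is removed up to a point
    \<open>t\<close> of \<open>C\<close>, there are at most as many components as points of
    \<open>C\<close> up to \<open>t\<close>. The induction is on the number of points of
    \<open>C\<close> before \<open>t\<close>.\<close>
  have step: "finite (components (- (A \<union> complex_of_real ` {a..t}))) \<and>
    card (components (- (A \<union> complex_of_real ` {a..t}))) \<le> card {c \<in> C. c \<le> t}" if "t \<in> C" for t
    using that
  proof (induction "card {c \<in> C. c < t}" arbitrary: t rule: less_induct)
    case less
    have t: "a < t" "t < b" "complex_of_real t \<in> A"
      using less.prems C(3) by (auto simp: C_def)
    show ?case
    proof (cases "{c \<in> C. c < t} = {}")
      case True
      obtain e where e: "e > 0" "\<And>x. \<bar>x - a\<bar> < e \<Longrightarrow> complex_of_real x \<notin> A"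
        using gap[of a] by auto
      have "complex_of_real x \<notin> A" if "x \<in> {a - e<..<t}" for x
      proof (cases "x < a")
        case True
        then show ?thesis using e that by auto
      next
        case False
        then have "a \<le> x" "x \<le> b" "x < t"
          using that t by auto
        then show ?thesis
          using \<open>{c \<in> C. c < t} = {}\<close> unfolding C_def by blast
      qed
      then have J: "complex_of_real ` {a - e<..<t} \<subseteq> - A"
        by blast
      have M: "{a - e<..<t} - {a..<t} = {a - e<..<a}"
        using t by auto
      \<comment> \<open>The point \<open>t\<close> is in \<open>A\<close>, so removing the half-open
        piece already gives the set for the closed one.\<close>
      have eq: "- A - complex_of_real ` {a..<t} = - (A \<union> complex_of_real ` {a..t})"
        using t by (auto simp: image_iff Bex_def order_le_less)
      have "components (- A) \<subseteq> {- A}"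
        using A(2) connected_eq_components_subset_sing by blast
      then have cA: "finite (components (- A))" "card (components (- A)) \<le> 1"
        using finite_subset card_mono[of "{- A}" "components (- A)"] by auto
      have "finite (components (- A - complex_of_real ` {a..<t})) \<and>
        card (components (- A - complex_of_real ` {a..<t})) \<le> card (components (- A))"
      proof (rule card_components_remove_dangling[OF _ ne(2) J])
        show "{a..<t} \<subseteq> {a - e<..<t}" using e(1) by auto
        show "connected ({a - e<..<t} - {a..<t})" "{a - e<..<t} - {a..<t} \<noteq> {}"
          unfolding M using e(1) by auto
        show "open (- A - complex_of_real ` {a..<t})"
          unfolding eq by (rule op)
      qed (use A(1) cA t in auto)
      moreover have "card {c \<in> C. c \<le> t} \<ge> 1"
        using less.prems C(1) by (simp add: Suc_le_eq card_gt_0_iff) blast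
      ultimately show ?thesis
        using cA unfolding eq by linarith
    next
      case False
      \<comment> \<open>The predecessor of \<open>t\<close> in \<open>C\<close>. No point of
        \<open>A\<close> lies between them on the line, so the open piece from \<open>p\<close> to
        \<open>t\<close> is a full edge and costs at most one component.\<close>
      define p where "p = Max {c \<in> C. c < t}"
      have "p \<in> {c \<in> C. c < t}"
        unfolding p_def using C(1) False by (intro Max_in) auto
      then have p: "p \<in> C" "p < t" by auto
      have pmax: "c \<le> p" if "c \<in> C" "c < t" for c
        unfolding p_def using C(1) that by (intro Max_ge) auto
      have "{c \<in> C. c < p} \<subset> {c \<in> C. c < t}"
        using p by fastforce
      then have "card {c \<in> C. c < p} < card {c \<in> C. c < t}"
        using C(1) by (intro psubset_card_mono) auto
      from less.hyps[OF this p(1)]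
      have IH: "finite (components (- (A \<union> complex_of_real ` {a..p})))"
        "card (components (- (A \<union> complex_of_real ` {a..p}))) \<le> card {c \<in> C. c \<le> p}"
        by auto
      have pA: "complex_of_real p \<in> A" "a < p"
        using p C(3) by (auto simp: C_def)
      have J: "complex_of_real ` {p<..<t} \<subseteq> - (A \<union> complex_of_real ` {a..p})"
        using pmax pA t by (fastforce simp: C_def)
      have eq: "- (A \<union> complex_of_real ` {a..p}) - complex_of_real ` {p<..<t}
          = - (A \<union> complex_of_real ` {a..t})"
      proof -
        have "{a..t} = {a..p} \<union> {p<..<t} \<union> {t}"
          using p pA by auto
        then show ?thesis
          using t(3) by auto
      qed
      have "finite (components (- (A \<union> complex_of_real ` {a..t}))) \<and>
        card (components (- (A \<union> complex_of_real ` {a..t})))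
          \<le> card (components (- (A \<union> complex_of_real ` {a..p}))) + 1"
        using card_components_remove_edge[OF op ne(1) p(2) J] IH(1) op[of a t] unfolding eq by blast
      moreover have "card {c \<in> C. c \<le> p} < card {c \<in> C. c \<le> t}"
      proof (rule psubset_card_mono)
        have "t \<in> {c \<in> C. c \<le> t} - {c \<in> C. c \<le> p}"
          using p less.prems by simp
        then show "{c \<in> C. c \<le> p} \<subset> {c \<in> C. c \<le> t}"
          using p by fastforce
      qed (use C(1) in simp)
      ultimately show ?thesis
        using IH(2) by linarith
    qed
  qed
  \<comment> \<open>Beyond the last point of \<open>C\<close> only the dangling right end
    remains.\<close>
  define t where "t = Max C"
  have t: "t \<in> C" "\<And>c. c \<in> C \<Longrightarrow> c \<le> t"
    unfolding t_def using C by auto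
  have tb: "t < b" "a < t"
    using t C(3) by auto
  obtain e where e: "e > 0" "\<And>x. \<bar>x - b\<bar> < e \<Longrightarrow> complex_of_real x \<notin> A"
    using gap[of b] by auto
  have "complex_of_real x \<notin> A" if "x \<in> {t<..<b + e}" for x
  proof (cases "x > b")
    case True
    then show ?thesis using e that by auto
  next
    case False
    then show ?thesis
      using t(2)[of x] that tb by (auto simp: C_def)
  qed
  then have J: "complex_of_real ` {t<..<b + e} \<subseteq> - (A \<union> complex_of_real ` {a..t})"
    by auto
  have M: "{t<..<b + e} - {t<..b} = {b<..<b + e}"
    using tb by auto
  have eq: "- (A \<union> complex_of_real ` {a..t}) - complex_of_real ` {t<..b}
      = - (A \<union> complex_of_real ` {a..b})"
  proof -
    have "{a..b} = {a..t} \<union> {t<..b}"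
      using tb by auto
    then show ?thesis by auto
  qed
  have "finite (components (- (A \<union> complex_of_real ` {a..t}) - complex_of_real ` {t<..b})) \<and>
    card (components (- (A \<union> complex_of_real ` {a..t}) - complex_of_real ` {t<..b}))
      \<le> card (components (- (A \<union> complex_of_real ` {a..t})))"
  proof (rule card_components_remove_dangling[OF op ne(1) J])
    show "{t<..b} \<subseteq> {t<..<b + e}" using e(1) by auto
    show "connected ({t<..<b + e} - {t<..b})" "{t<..<b + e} - {t<..b} \<noteq> {}"
      unfolding M using e(1) by auto
    show "open (- (A \<union> complex_of_real ` {a..t}) - complex_of_real ` {t<..b})"
      unfolding eq by (rule op)
  qed (use step[OF t(1)] tb in auto)
  moreover have "{c \<in> C. c \<le> t} = C"
    using t(2) by auto
  ultimately show ?thesis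
    using step[OF t(1)] unfolding eq by auto
qed

section \<open>Crossings, regions and the lower bound\<close>

text \<open>An accumulation point of the parameters in \<open>Z\<close> would itself be in
  \<open>Z\<close>, hence an interior parameter where the arc crosses transversally. There the curve
  is off the line at all nearby parameters, so none accumulate, and compactness of the unit interval
  gives finiteness.\<close>

lemma finite_crossings:
  assumes "open_meander \<gamma>"
  shows "finite (crossings \<gamma>)"
proof -
  define Z where "Z = {t \<in> {0..1}. Im (\<gamma> t) = 0}"
  have cont: "continuous_on {0..1} \<gamma>"
    using assms by (auto simp: open_meander_def arc_def path_def)
  have closed: "closed Z"
    unfolding Z_def by (intro continuous_closed_preimage_constant continuous_intros cont)
  have "\<not> t islimpt Z" if t: "t \<in> {0..1}" for t
  proof
    assume lim: "t islimpt Z"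
    then have "t \<in> Z"
      using closed closed_limpt by blast
    then have "t \<noteq> 0" "t \<noteq> 1" "\<gamma> t \<in> horizontal_line"
      using assms by (auto simp: Z_def open_meander_def horizontal_line_def pathstart_def pathfinish_def)
    then have "crosses_line_at \<gamma> t"
      using assms t by (auto simp: open_meander_def)
    then obtain e where e: "e > 0"
      "\<And>s. 0 < s \<Longrightarrow> s < e \<Longrightarrow> Im (\<gamma> (t - s)) * Im (\<gamma> (t + s)) < 0"
      by (auto simp: crosses_line_at_def)
    obtain u where u: "u \<in> Z" "u \<noteq> t" "dist u t < e"
      using lim e(1) by (auto simp: islimpt_approachable)
    have "Im (\<gamma> (t - \<bar>u - t\<bar>)) * Im (\<gamma> (t + \<bar>u - t\<bar>)) < 0"
      using u by (intro e) (auto simp: dist_real_def)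
    \<comment> \<open>The nearby zero \<open>u\<close> is one of the two parameters symmetric about
      \<open>t\<close>, so the product would vanish.\<close>
    moreover have "t - \<bar>u - t\<bar> = u \<or> t + \<bar>u - t\<bar> = u"
      by linarith
    ultimately show False
      using u(1) by (auto simp: Z_def)
  qed
  then have "finite ({0..1} \<inter> Z)"
    by (intro finite_not_islimpt_in_compact) auto
  moreover have "crossings \<gamma> = \<gamma> ` ({0..1} \<inter> Z)"
    by (auto simp: crossings_def path_image_def horizontal_line_def Z_def)
  ultimately show ?thesis by simp
qed

lemma closed_segment_of_real_eq:
  "a \<le> b \<Longrightarrow> closed_segment (complex_of_real a) (complex_of_real b) = complex_of_real ` {a..b}"
  using closed_segment_linear_image[OF bounded_linear.linear[OF bounded_linear_of_real], of a b]
  by (simp add: closed_segment_eq_real_ivl)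

text \<open>The sweep starts from the complement of the arc, which is connected because an arc does
  not separate the plane. All crossings lie inside the segment, so they correspond exactly to the
  points of \<open>C\<close>.\<close>

lemma card_regions_le:
  assumes "doubly_anchored_open_meander \<gamma> a b" "crossings \<gamma> \<noteq> {}"
  shows "card (regions \<gamma> a b) \<le> card (crossings \<gamma>)"
proof -
  let ?A = "path_image \<gamma>"
  have m: "open_meander \<gamma>" "a < b" "crossings \<gamma> \<subseteq> complex_of_real ` {a<..<b}"
    using assms by (auto simp: doubly_anchored_open_meander_def)
  define C where "C = {x. complex_of_real x \<in> ?A \<and> a \<le> x \<and> x \<le> b}"
  have mem: "complex_of_real x \<in> crossings \<gamma> \<longleftrightarrow> complex_of_real x \<in> ?A" for x
    by (auto simp: crossings_def horizontal_line_def)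
  have cr: "crossings \<gamma> = complex_of_real ` C"
  proof
    show "complex_of_real ` C \<subseteq> crossings \<gamma>"
      using mem by (auto simp: C_def)
    show "crossings \<gamma> \<subseteq> complex_of_real ` C"
    proof
      fix z assume z: "z \<in> crossings \<gamma>"
      then obtain x where x: "x \<in> {a<..<b}" "z = complex_of_real x"
        using m(3) by blast
      then have "x \<in> C"
        using z mem by (auto simp: C_def)
      then show "z \<in> complex_of_real ` C"
        using x by blast
    qed
  qed
  have "arc \<gamma>"
    using m by (simp add: open_meander_def)
  then have "connected (- ?A)"
    using connected_arc_complement by (metis DIM_complex order_refl)
  moreover have "finite C"
    using finite_crossings[OF m(1)] finite_imageD[of complex_of_real C] unfolding cr
    by (simp add: inj_on_def)
  moreover have "C \<subseteq> {a<..<b}"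
    using m(3) unfolding cr by auto
  ultimately have "card (components (- (?A \<union> complex_of_real ` {a..b}))) \<le> card C"
    using card_components_Compl_Un_segment[of ?A a b] m assms(2) closed_arc_image[OF \<open>arc \<gamma>\<close>]
    by (simp add: C_def[symmetric] cr)
  then show ?thesis
    using m by (simp add: regions_def meander_graph_def closed_segment_of_real_eq Un_commute
        cr card_image inj_on_def)
qed

text \<open>Without crossings, deleting the vertices leaves the open segment \<open>S\<close> and
  the open arc \<open>A\<close>. Each is connected, so there are at most two edges.\<close>

lemma num_sides_le_2:
  assumes "doubly_anchored_open_meander \<gamma> a b" "crossings \<gamma> = {}"
  shows "num_sides \<gamma> a b R \<le> 2"
proof -
  have m: "open_meander \<gamma>" "a < b"
    using assms by (auto simp: doubly_anchored_open_meander_def)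
  define S A where "S = complex_of_real ` {a<..<b}" and "A = \<gamma> ` {0<..<1}"
  have arc: "arc \<gamma>"
    using m by (simp add: open_meander_def)
  have A_eq: "A = path_image \<gamma> - {pathstart \<gamma>, pathfinish \<gamma>}"
    using simple_path_endless[OF arc_imp_simple_path[OF arc]] by (simp add: A_def)
  have S_eq: "S = complex_of_real ` {a..b} - {complex_of_real a, complex_of_real b}"
    by (auto simp: S_def)
  have nocross: "complex_of_real x \<notin> path_image \<gamma>" for x
    using assms(2) by (auto simp: crossings_def horizontal_line_def)
  have graph: "meander_graph \<gamma> a b - (crossings \<gamma> \<union> anchors \<gamma> a b) = S \<union> A"
  proof -
    have "complex_of_real a \<notin> path_image \<gamma>" "complex_of_real b \<notin> path_image \<gamma>"
      using nocross by auto
    moreover have "complex_of_real ` {a..b} \<inter> path_image \<gamma> = {}"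
      using nocross by auto
    then have "pathstart \<gamma> \<notin> complex_of_real ` {a..b}" "pathfinish \<gamma> \<notin> complex_of_real ` {a..b}"
      using pathstart_in_path_image[of \<gamma>] pathfinish_in_path_image[of \<gamma>] by blast+
    ultimately show ?thesis
      unfolding meander_graph_def anchors_def A_eq S_eq closed_segment_of_real_eq[OF less_imp_le[OF m(2)]]
        assms(2) by blast
  qed
  have "connected S"
    unfolding S_def by (intro connected_continuous_image continuous_intros) auto
  then obtain D where D: "D \<in> components (S \<union> A)" "S \<subseteq> D"
    using exists_component_superset[of S "S \<union> A"] m(2) by (auto simp: S_def)
  have "connected A"
    unfolding A_eq by (rule connected_simple_path_endless[OF arc_imp_simple_path[OF arc]])
  then obtain E where E: "E \<in> components (S \<union> A)" "A \<subseteq> E"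
    using exists_component_superset[of A "S \<union> A"] m(2) by (auto simp: S_def)
  have "edges \<gamma> a b \<subseteq> {D, E}"
  proof
    fix e assume "e \<in> edges \<gamma> a b"
    then have e: "e \<in> components (S \<union> A)"
      by (simp add: edges_def graph)
    then obtain x where "x \<in> e" "x \<in> S \<union> A"
      using in_components_nonempty in_components_subset by blast
    then show "e \<in> {D, E}"
      using D E e components_eq by blast
  qed
  then have "{e \<in> edges \<gamma> a b. e \<subseteq> frontier R} \<subseteq> {D, E}"
    by blast
  then have "num_sides \<gamma> a b R \<le> card {D, E}"
    unfolding num_sides_def by (intro card_mono) auto
  also have "\<dots> \<le> 2"
    by (simp add: card_insert_if)
  finally show ?thesis .
qed

lemma card_crossings_ge:
  fixes k :: nat
  assumes m: "doubly_anchored_open_meander \<gamma> a b"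
    and st: "in_stratum \<gamma> a b (add_mset (int k) (replicate_mset (k + 4) (-1)))"
  shows "k + 1 \<le> card (crossings \<gamma>)"
proof -
  obtain z where z: "meander_orders \<gamma> a b =
    image_mset of_int (add_mset (int k) (replicate_mset (k + 4) (-1))) + replicate_mset z 0"
    using st by (auto simp: in_stratum_def)
  have "crossings \<gamma> \<noteq> {}"
  proof
    assume no: "crossings \<gamma> = {}"
    have "of_nat k \<in># meander_orders \<gamma> a b"
      unfolding z by simp
    \<comment> \<open>The anchors contribute only \<open>-1\<close>, so the entry \<open>k\<close>
      is the order of a region, which then needs at least four sides.\<close>
    then obtain R where "region_order \<gamma> a b R = of_nat k"
      by (auto simp: meander_orders_def split: if_splits)
    then have "(of_nat (num_sides \<gamma> a b R) :: rat) = of_nat (2 * k + 4)"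
      by (simp add: region_order_def field_simps)
    then show False
      using num_sides_le_2[OF m no, of R] unfolding of_nat_eq_iff by linarith
  qed
  from card_regions_le[OF m this] have "card (regions \<gamma> a b) \<le> card (crossings \<gamma>)" .
  \<comment> \<open>Sizes of the two multisets are compared: one entry \<open>k\<close>,
    \<open>k + 4\<close> entries \<open>-1\<close> and \<open>z\<close> zeros.\<close>
  moreover have "card (regions \<gamma> a b) + card (anchors \<gamma> a b) = k + 5 + z"
    using arg_cong[OF z, of size] by (simp add: meander_orders_def)
  moreover have "card (anchors \<gamma> a b) \<le> 4"
    unfolding anchors_def by (simp add: card_insert_if)
  ultimately show ?thesis
    by linarith
qed

section \<open>The sine curve\<close>

text \<open>Meant for edges, whose union is not open in the plane, so that openness is only relative
  to the union.\<close>

lemma components_Union_eqI: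
  assumes "\<And>C. C \<in> F \<Longrightarrow> connected C \<and> C \<noteq> {}"
    and open_in: "\<And>C. C \<in> F \<Longrightarrow> \<exists>U. open U \<and> C = \<Union>F \<inter> U"
    and disj: "pairwise disjnt F"
  shows "components (\<Union>F) = F"
proof -
  have *: "C \<in> components (\<Union>F)" if C: "C \<in> F" for C
  proof -
    obtain D where D: "D \<in> components (\<Union>F)" "C \<subseteq> D"
      using exists_component_superset[of C "\<Union>F"] assms(1)[OF C] C by blast
    obtain U where U: "\<And>B. B \<in> F \<Longrightarrow> open (U B) \<and> B = \<Union>F \<inter> U B"
      using open_in by metis
    \<comment> \<open>Within \<open>D\<close>, the open sets \<open>U C\<close> and \<open>V\<close>
      separate \<open>C\<close> from all other members, so the connected \<open>D\<close> can be no
      larger than \<open>C\<close>.\<close>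
    define V where "V = (\<Union>B\<in>F - {C}. U B)"
    have "open (U C)" "open V"
      using U C by (auto simp: V_def)
    have mem: "z \<in> B \<longleftrightarrow> z \<in> U B" if "z \<in> D" "B \<in> F" for z B
      using U[OF that(2)] that(1) in_components_subset[OF D(1)] by blast
    have "z \<notin> U B" if "z \<in> D" "z \<in> U C" "B \<in> F - {C}" for z B
      using mem[of z B] mem[of z C] disj C that by (auto simp: pairwise_def disjnt_def)
    then have "U C \<inter> V \<inter> D = {}"
      unfolding V_def by blast
    have cover: "D \<subseteq> U C \<union> V"
    proof
      fix z assume z: "z \<in> D"
      then obtain B where "B \<in> F" "z \<in> B"
        using in_components_subset[OF D(1)] by blast
      then show "z \<in> U C \<union> V"
        using mem[OF z] by (cases "B = C") (auto simp: V_def)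
    qed
    have "U C \<inter> D = {} \<or> V \<inter> D = {}"
      by (rule connectedD[OF in_components_connected[OF D(1)]]) fact+
    moreover have "U C \<inter> D \<noteq> {}"
      using assms(1)[OF C] D(2) mem[OF _ C] by fast
    ultimately have "D \<subseteq> U C"
      using cover by blast
    then have "D \<subseteq> C"
      using mem[OF _ C] by blast
    then show ?thesis
      using D by (metis subset_antisym)
  qed
  moreover have "D \<in> F" if D: "D \<in> components (\<Union>F)" for D
  proof -
    obtain x C where "x \<in> D" "x \<in> C" "C \<in> F"
      using in_components_nonempty[OF D] in_components_subset[OF D] by blast
    then show ?thesis
      using *[of C] components_eq[OF D] by blast
  qed
  ultimately show ?thesis by blast
qed

section \<open>The sine curve as a doubly-anchored meander\<close>

text \<open>The factor \<open>pi\<close> puts the zeros at the integers, which makes the crossings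
  integers too.\<close>

definition wave :: "real \<Rightarrow> real" where
  "wave x = sin (pi * x)"

lemma wave_eq_0_iff: "wave x = 0 \<longleftrightarrow> x \<in> \<int>"
proof -
  have "wave x = 0 \<longleftrightarrow> (\<exists>i::int. pi * x = of_int i * pi)"
    by (simp add: wave_def sin_zero_iff_int2)
  also have "\<dots> \<longleftrightarrow> x \<in> \<int>"
    by (auto simp: Ints_def)
  finally show ?thesis .
qed

lemma continuous_on_wave: "continuous_on X wave"
  unfolding wave_def by (intro continuous_intros)

lemma not_Ints_between: "of_int j < x \<Longrightarrow> x < of_int j + 1 \<Longrightarrow> (x::real) \<notin> \<int>"
  by (auto elim!: Ints_cases)

lemma floor_eq_if_between: "of_int i < (x::real) \<Longrightarrow> x < of_int i + 1 \<Longrightarrow> \<lfloor>x\<rfloor> = i"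
  by linarith

text \<open>The last case uses the quotient \<open>y / w\<close> because this is the height
  coordinate of \<open>band\<close>; it treats both signs of \<open>w\<close> at once.\<close>

lemma between_cases:
  fixes y w :: real
  obtains "y > max 0 w" | "y < min 0 w" | "y = 0 \<or> y = w" | "0 < y / w" "y / w < 1" "w \<noteq> 0"
  by (cases w "0::real" rule: linorder_cases; cases y "0::real" rule: linorder_cases;
      cases y w rule: linorder_cases) (auto simp: field_simps)

locale sine_meander =
  fixes k :: nat
begin

text \<open>The ends lie half a unit beyond the outermost crossings \<open>0\<close> and
  \<open>k\<close>. The sine is nonzero there, so the path ends off the line and the four anchors
  are distinct.\<close>

definition lo :: real where "lo = - 1 / 2"
definition hi :: real where "hi = real k + 1 / 2"

definition \<gamma> :: "real \<Rightarrow> complex" where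
  "\<gamma> t = Complex (lo + (real k + 1) * t) (wave (lo + (real k + 1) * t))"

text \<open>The relevant indices run from \<open>-1\<close> to \<open>k\<close>. The first and last
  cells are halved by \<open>lo\<close> and \<open>hi\<close> and carry the edges at the anchors;
  the others are the gaps between consecutive crossings.\<close>

definition cell :: "int \<Rightarrow> real set" where
  "cell j = {of_int j<..<of_int j + 1} \<inter> {lo<..<hi}"

definition lobe :: "int \<Rightarrow> complex set" where
  "lobe j = band wave {of_int j<..<of_int j + 1} {0<..<1}"

text \<open>The path covers only half of the two outermost lobes, so these are open to the outer region.\<close>

definition outer :: "complex set" where
  "outer = {z. Im z > max 0 (wave (Re z))} \<union> {z. Im z < min 0 (wave (Re z))}
    \<union> ({z. Re z < lo} \<union> lobe (-1)) \<union> ({z. Re z > hi} \<union> lobe (int k))"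

lemma lo_hi: "lo < 0" "lo > -1" "hi > k" "hi < k + 1" "lo < hi" "lo \<notin> \<int>" "hi \<notin> \<int>"
proof -
  show "lo \<notin> \<int>" using not_Ints_between[of "-1" lo] by (simp add: lo_def)
  show "hi \<notin> \<int>" using not_Ints_between[of "int k" hi] by (simp add: hi_def)
qed (auto simp: lo_def hi_def)

lemma \<gamma>_image: "path_image \<gamma> = {z. lo \<le> Re z \<and> Re z \<le> hi \<and> Im z = wave (Re z)}"
proof
  show "path_image \<gamma> \<subseteq> {z. lo \<le> Re z \<and> Re z \<le> hi \<and> Im z = wave (Re z)}"
  proof
    fix z assume "z \<in> path_image \<gamma>"
    then obtain t where t: "0 \<le> t" "t \<le> 1" "z = \<gamma> t"
      by (auto simp: path_image_def)
    define u where "u = (real k + 1) * t"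
    have "0 \<le> u" "u \<le> real k + 1"
      using t by (simp_all add: u_def mult_left_le)
    moreover have "z = Complex (lo + u) (wave (lo + u))"
      by (simp add: t \<gamma>_def u_def)
    ultimately show "z \<in> {z. lo \<le> Re z \<and> Re z \<le> hi \<and> Im z = wave (Re z)}"
      by (simp add: lo_def hi_def)
  qed
  show "{z. lo \<le> Re z \<and> Re z \<le> hi \<and> Im z = wave (Re z)} \<subseteq> path_image \<gamma>"
  proof
    fix z assume z: "z \<in> {z. lo \<le> Re z \<and> Re z \<le> hi \<and> Im z = wave (Re z)}"
    define t where "t = (Re z - lo) / (real k + 1)"
    have "t \<in> {0..1}"
      using z by (auto simp: t_def lo_def hi_def field_simps)
    moreover have "z = \<gamma> t"
      using z by (simp add: t_def \<gamma>_def complex_eq_iff)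
    ultimately show "z \<in> path_image \<gamma>"
      by (auto simp: path_image_def)
  qed
qed

lemma \<gamma>_ends: "pathstart \<gamma> = Complex lo (wave lo)" "pathfinish \<gamma> = Complex hi (wave hi)"
  by (auto simp: pathstart_def pathfinish_def \<gamma>_def lo_def hi_def add.commute)

lemma graph_eq:
  "meander_graph \<gamma> lo hi = {z. lo \<le> Re z \<and> Re z \<le> hi \<and> (Im z = 0 \<or> Im z = wave (Re z))}"
proof -
  have "closed_segment (complex_of_real lo) (complex_of_real hi)
      = {z. lo \<le> Re z \<and> Re z \<le> hi \<and> Im z = 0}"
    using lo_hi by (auto simp: closed_segment_of_real_eq complex_eq_iff image_iff)
  then show ?thesis
    by (auto simp: meander_graph_def \<gamma>_image)
qed

lemma crossings_eq: "crossings \<gamma> = (\<lambda>j. complex_of_real (of_int j)) ` {0..int k}"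
proof
  show "crossings \<gamma> \<subseteq> (\<lambda>j. complex_of_real (of_int j)) ` {0..int k}"
  proof
    fix z assume "z \<in> crossings \<gamma>"
    then have z: "lo \<le> Re z" "Re z \<le> hi" "Im z = 0" "wave (Re z) = 0"
      by (auto simp: crossings_def \<gamma>_image horizontal_line_def)
    then obtain j :: int where j: "Re z = of_int j"
      by (auto simp: wave_eq_0_iff elim: Ints_cases)
    have "-1 < j" "j < int k + 1"
      using z j lo_hi by linarith+
    then show "z \<in> (\<lambda>j. complex_of_real (of_int j)) ` {0..int k}"
      using j z by (intro image_eqI[of _ _ j]) (auto simp: complex_eq_iff)
  qed
  show "(\<lambda>j. complex_of_real (of_int j)) ` {0..int k} \<subseteq> crossings \<gamma>"
  proof
    fix z assume "z \<in> (\<lambda>j. complex_of_real (of_int j)) ` {0..int k}"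
    then obtain j where j: "0 \<le> j" "j \<le> int k" "z = complex_of_real (of_int j)"
      by auto
    then have "lo \<le> of_int j" "of_int j \<le> hi"
      using lo_hi by linarith+
    then show "z \<in> crossings \<gamma>"
      using j wave_eq_0_iff[of "of_int j"]
      by (simp add: crossings_def \<gamma>_image horizontal_line_def)
  qed
qed

lemma card_crossings: "card (crossings \<gamma>) = k + 1"
  unfolding crossings_eq by (subst card_image) (auto simp: inj_on_def)

lemma doubly_anchored: "doubly_anchored_open_meander \<gamma> lo hi"
proof -
  have "arc \<gamma>"
    unfolding arc_def path_def
  proof
    show "continuous_on {0..1} \<gamma>"
      unfolding \<gamma>_def Complex_eq wave_def by (intro continuous_intros)
    show "inj_on \<gamma> {0..1}"
      by (auto simp: inj_on_def \<gamma>_def)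
  qed
  moreover have "crosses_line_at \<gamma> t" if t: "t \<in> {0<..<1}" "\<gamma> t \<in> horizontal_line" for t
  proof -
    define x where "x = lo + (real k + 1) * t"
    have x: "sin (pi * x) = 0"
      using t by (simp add: horizontal_line_def \<gamma>_def x_def wave_def)
    \<comment> \<open>A parameter change below \<open>1 / (real k + 1)\<close> moves the abscissa by
      less than one unit, so the angle \<open>u\<close> stays below \<open>pi\<close>. At a zero of
      the sine, the addition formulas turn the product into minus the square of
      \<open>sin u\<close>.\<close>
    have "Im (\<gamma> (t - s)) * Im (\<gamma> (t + s)) < 0" if s: "0 < s" "s < 1 / (real k + 1)" for s
    proof -
      define u where "u = pi * ((real k + 1) * s)"
      have "0 < (real k + 1) * s" "(real k + 1) * s < 1"
        using s by (auto simp: pos_less_divide_eq mult.commute)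
      then have "0 < u" "u < pi"
        unfolding u_def using mult_strict_left_mono[of "(real k + 1) * s" 1 pi] by auto
      then have "sin u > 0"
        by (rule sin_gt_zero)
      have "Im (\<gamma> (t - s)) = sin (pi * x - u)" "Im (\<gamma> (t + s)) = sin (pi * x + u)"
        by (simp_all add: \<gamma>_def x_def u_def wave_def algebra_simps)
      then have "Im (\<gamma> (t - s)) * Im (\<gamma> (t + s)) = - ((cos (pi * x))\<^sup>2 * (sin u)\<^sup>2)"
        using x by (simp add: sin_diff sin_add power2_eq_square)
      also have "(cos (pi * x))\<^sup>2 = 1"
        using x by (simp add: cos_squared_eq)
      finally show ?thesis
        using \<open>sin u > 0\<close> by simp
    qed
    then show ?thesis
      using t(2) unfolding crosses_line_at_def by (intro conjI exI[of _ "1 / (real k + 1)"]) auto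
  qed
  moreover have "crossings \<gamma> \<subseteq> complex_of_real ` {lo<..<hi}"
  proof -
    have "lo < of_int j \<and> of_int j < hi" if "0 \<le> j" "j \<le> int k" for j
      using that lo_hi by linarith
    then show ?thesis
      unfolding crossings_eq by (intro image_subsetI imageI) auto
  qed
  moreover have "wave lo \<noteq> 0" "wave hi \<noteq> 0"
    using lo_hi by (auto simp: wave_eq_0_iff)
  ultimately show ?thesis
    using lo_hi by (simp add: doubly_anchored_open_meander_def open_meander_def \<gamma>_ends horizontal_line_def)
qed

lemma card_anchors: "card (anchors \<gamma> lo hi) = 4"
  using lo_hi by (simp add: anchors_def \<gamma>_ends card_insert_if complex_eq_iff wave_eq_0_iff)

section \<open>Edges of the sine meander\<close>

lemma cell_subset: "cell j \<subseteq> {of_int j<..<of_int j + 1}"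
  by (auto simp: cell_def)

lemma wave_nz: "x \<in> {of_int j<..<of_int j + 1} \<Longrightarrow> wave x \<noteq> 0"
  using not_Ints_between[of j x] by (auto simp: wave_eq_0_iff)

lemma wave_nz_cell: "x \<in> cell j \<Longrightarrow> wave x \<noteq> 0"
  using cell_subset wave_nz by blast

lemma cell_props:
  assumes "j \<in> {-1..int k}"
  shows "connected (cell j)" "open (cell j)" "cell j \<noteq> {}"
proof -
  have eq: "cell j = {max (of_int j) lo<..<min (of_int j + 1) hi}"
    by (auto simp: cell_def)
  have "of_int j < hi" "lo < of_int j + 1"
    using assms lo_hi by auto
  then have "max (of_int j) lo < min (of_int j + 1) hi"
    using lo_hi by simp
  then show "connected (cell j)" "open (cell j)" "cell j \<noteq> {}"
    unfolding eq by auto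
qed

lemma cell_inner: "0 \<le> j \<Longrightarrow> j < int k \<Longrightarrow> cell j = {of_int j<..<of_int j + 1}"
  using lo_hi unfolding cell_def by auto

lemma in_cell_floor:
  assumes "lo < x" "x < hi" "x \<notin> \<int>"
  shows "x \<in> cell \<lfloor>x\<rfloor>" "\<lfloor>x\<rfloor> \<in> {-1..int k}"
proof -
  have "x \<noteq> of_int \<lfloor>x\<rfloor>"
    using assms(3) by (metis Ints_of_int)
  then have "of_int \<lfloor>x\<rfloor> < x" "x < of_int \<lfloor>x\<rfloor> + 1"
    by linarith+
  then show "x \<in> cell \<lfloor>x\<rfloor>" using assms by (auto simp: cell_def)
  show "\<lfloor>x\<rfloor> \<in> {-1..int k}"
    using assms lo_hi by (simp add: le_floor_iff floor_le_iff) 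
qed

lemma mem_edge: "z \<in> band wave (cell j) {c} \<longleftrightarrow> Re z \<in> cell j \<and> Im z = c * wave (Re z)"
  using mem_band[of "cell j" wave z "{c}"] wave_nz_cell by (auto simp: field_simps)

lemma mem_lobe:
  "z \<in> lobe j \<longleftrightarrow> of_int j < Re z \<and> Re z < of_int j + 1 \<and> 0 < Im z / wave (Re z) \<and> Im z / wave (Re z) < 1"
  unfolding lobe_def
  using mem_band[where X="{of_int j<..<of_int j + 1}" and f=wave and Y="{0<..<1}" and z=z] wave_nz
  by auto

text \<open>Over each cell, \<open>c = 0\<close> gives the edge on the segment and
  \<open>c = 1\<close> the edge on the path. Writing both as degenerate bands puts edges and lobes
  in the same coordinates.\<close>

definition edge_set :: "complex set set" where
  "edge_set = (\<lambda>(j, c). band wave (cell j) {c}) ` ({-1..int k} \<times> {0, 1})"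

lemma edge_setE:
  assumes "e \<in> edge_set"
  obtains j c where "j \<in> {-1..int k}" "c \<in> {0, 1}" "e = band wave (cell j) {c}"
  using assms unfolding edge_set_def image_iff by (metis (no_types, lifting) SigmaE case_prod_conv)

lemma Union_edge_set: "\<Union>edge_set = meander_graph \<gamma> lo hi - (crossings \<gamma> \<union> anchors \<gamma> lo hi)"
proof
  show "\<Union>edge_set \<subseteq> meander_graph \<gamma> lo hi - (crossings \<gamma> \<union> anchors \<gamma> lo hi)"
  proof
    fix z assume "z \<in> \<Union>edge_set"
    then obtain j c where z: "Re z \<in> cell j" "Im z = c * wave (Re z)" "c \<in> {0, 1}"
      by (metis UnionE edge_setE mem_edge)
    have "Re z \<notin> \<int>"
      using wave_nz_cell[OF z(1)] by (simp add: wave_eq_0_iff)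
    then have "z \<notin> crossings \<gamma>"
      unfolding crossings_eq by auto
    moreover have "lo < Re z" "Re z < hi"
      using z(1) by (auto simp: cell_def)
    then have "z \<notin> anchors \<gamma> lo hi"
      by (auto simp: anchors_def \<gamma>_ends)
    moreover have "z \<in> meander_graph \<gamma> lo hi"
      using z \<open>lo < Re z\<close> \<open>Re z < hi\<close> by (auto simp: graph_eq)
    ultimately show "z \<in> meander_graph \<gamma> lo hi - (crossings \<gamma> \<union> anchors \<gamma> lo hi)"
      by blast
  qed
  show "meander_graph \<gamma> lo hi - (crossings \<gamma> \<union> anchors \<gamma> lo hi) \<subseteq> \<Union>edge_set"
  proof
    fix z assume z: "z \<in> meander_graph \<gamma> lo hi - (crossings \<gamma> \<union> anchors \<gamma> lo hi)"
    then have g: "lo \<le> Re z" "Re z \<le> hi" "Im z = 0 \<or> Im z = wave (Re z)"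
      by (auto simp: graph_eq)
    have "Re z \<noteq> lo" "Re z \<noteq> hi"
      using z g(3) by (auto simp: anchors_def \<gamma>_ends complex_eq_iff)
    moreover have "Re z \<notin> \<int>"
    proof
      assume "Re z \<in> \<int>"
      then have "wave (Re z) = 0"
        by (simp add: wave_eq_0_iff)
      then have "z \<in> crossings \<gamma>"
        using g by (auto simp: crossings_def \<gamma>_image horizontal_line_def)
      then show False
        using z by blast
    qed
    ultimately have "Re z \<in> cell \<lfloor>Re z\<rfloor>" "\<lfloor>Re z\<rfloor> \<in> {-1..int k}"
      using in_cell_floor[of "Re z"] g by auto
    then have "z \<in> band wave (cell \<lfloor>Re z\<rfloor>) {0} \<or> z \<in> band wave (cell \<lfloor>Re z\<rfloor>) {1}"
      using g(3) by (auto simp: mem_edge)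
    moreover have "band wave (cell \<lfloor>Re z\<rfloor>) {0} \<in> edge_set" "band wave (cell \<lfloor>Re z\<rfloor>) {1} \<in> edge_set"
      unfolding edge_set_def using \<open>\<lfloor>Re z\<rfloor> \<in> {-1..int k}\<close> by force+
    ultimately show "z \<in> \<Union>edge_set"
      by blast
  qed
qed

text \<open>The floor of the abscissa recovers the cell, and the height recovers \<open>c\<close>
  because the wave does not vanish on cells.\<close>

lemma edge_unique:
  assumes "z \<in> band wave (cell i) {c}" "z \<in> band wave (cell j) {d}"
  shows "i = j" "c = d"
proof -
  have z: "Re z \<in> cell i" "Re z \<in> cell j" "Im z = c * wave (Re z)" "Im z = d * wave (Re z)"
    using assms by (auto simp: mem_edge)
  show "i = j"
    using z(1,2) floor_eq_if_between[of i "Re z"] floor_eq_if_between[of j "Re z"] by (auto simp: cell_def)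
  show "c = d"
    using z wave_nz_cell by simp
qed

lemma edge_nonempty:
  assumes "j \<in> {-1..int k}"
  shows "band wave (cell j) {c} \<noteq> {}"
  using cell_props(3)[OF assms] by (auto simp: band_def)

lemma edges_eq: "edges \<gamma> lo hi = edge_set"
proof -
  have "components (\<Union>edge_set) = edge_set"
  proof (rule components_Union_eqI)
    fix C assume "C \<in> edge_set"
    then obtain j c where C: "j \<in> {-1..int k}" "c \<in> {0, 1}" "C = band wave (cell j) {c}"
      by (rule edge_setE)
    show "connected C \<and> C \<noteq> {}"
      unfolding C(3) using cell_props[OF C(1)] edge_nonempty[OF C(1)]
      by (auto intro!: connected_band continuous_on_wave)
    \<comment> \<open>The heights \<open>0\<close> and \<open>1\<close> differ by more than
      \<open>1/2\<close>, so this open band meets no edge other than \<open>C\<close>.\<close>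
    let ?U = "band wave (cell j) {c - 1/2<..<c + 1/2}"
    have "open ?U"
      using cell_props[OF C(1)] wave_nz_cell by (intro open_band continuous_on_wave) auto
    moreover have "C = \<Union>edge_set \<inter> ?U"
    proof
      show "C \<subseteq> \<Union>edge_set \<inter> ?U"
        using \<open>C \<in> edge_set\<close> unfolding C(3) band_def by (intro Int_greatest image_mono Sigma_mono) auto
      show "\<Union>edge_set \<inter> ?U \<subseteq> C"
      proof
        fix z assume z: "z \<in> \<Union>edge_set \<inter> ?U"
        then obtain d where d: "d \<in> {0, 1}" "Im z = d * wave (Re z)"
          by (metis IntD1 UnionE edge_setE mem_edge)
        have "Re z \<in> cell j" "Im z / wave (Re z) \<in> {c - 1/2<..<c + 1/2}"
          using z mem_band[of "cell j" wave z "{c - 1/2<..<c + 1/2}"] wave_nz_cell by auto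
        then have "d = c"
          using d C(2) wave_nz_cell by auto
        then show "z \<in> C"
          using d \<open>Re z \<in> cell j\<close> by (simp add: C(3) mem_edge)
      qed
    qed
    ultimately show "\<exists>U. open U \<and> C = \<Union>edge_set \<inter> U"
      by blast
  next
    show "pairwise disjnt edge_set"
    proof (rule pairwiseI)
      fix C D assume "C \<in> edge_set" "D \<in> edge_set" "C \<noteq> D"
      then obtain i c j d where "C = band wave (cell i) {c}" "D = band wave (cell j) {d}"
        by (metis edge_setE)
      then show "disjnt C D"
        using edge_unique \<open>C \<noteq> D\<close> unfolding disjnt_iff by metis
    qed
  qed
  then show ?thesis
    by (simp add: edges_def Union_edge_set)
qed

lemma card_edge_set: "finite edge_set" "card edge_set = 2 * (k + 2)"
proof -
  have "inj_on (\<lambda>(j, c). band wave (cell j) {c}) ({-1..int k} \<times> {0, 1::real})"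
  proof (rule inj_onI, clarify)
    fix i j c d
    assume "i \<in> {-1..int k}" and eq: "band wave (cell i) {c} = band wave (cell j) {d}"
    then obtain z where "z \<in> band wave (cell i) {c}"
      using edge_nonempty by blast
    then show "i = j \<and> c = d"
      using edge_unique eq by blast
  qed
  then have "card edge_set = card ({-1..int k} \<times> {0, 1::real})"
    unfolding edge_set_def by (rule card_image)
  then show "card edge_set = 2 * (k + 2)"
    by (simp add: card_cartesian_product)
  show "finite edge_set"
    unfolding edge_set_def by auto
qed

section \<open>Regions of the sine meander\<close>

lemma lobe_props: "open (lobe j)" "connected (lobe j)" "lobe j \<noteq> {}"
proof -
  show "open (lobe j)"
    unfolding lobe_def using wave_nz by (intro open_band continuous_on_wave) auto
  show "connected (lobe j)"
    unfolding lobe_def by (intro connected_band continuous_on_wave) auto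
  show "lobe j \<noteq> {}"
    unfolding lobe_def band_def by (auto intro: dense)
qed

lemma lobe_unique: "z \<in> lobe i \<Longrightarrow> z \<in> lobe j \<Longrightarrow> i = j"
  using floor_eq_if_between[of i "Re z"] floor_eq_if_between[of j "Re z"] by (auto simp: mem_lobe)

lemma open_outer: "open outer"
  unfolding outer_def using lobe_props continuous_on_wave
  by (intro open_Un open_Collect_less continuous_intros continuous_on_compose2[OF continuous_on_wave]) auto

text \<open>Four connected parts are chained together: \<open>A\<close> on the left meets both the
  part \<open>P\<close> above and the part \<open>N\<close> below, and \<open>B\<close> on the right
  meets \<open>P\<close>.\<close>

lemma connected_outer: "connected outer"
proof -
  define P N where "P = {z. Im z > max 0 (wave (Re z))}" and "N = {z. Im z < min 0 (wave (Re z))}"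
  define A B where "A = {z. Re z < lo} \<union> lobe (-1)" and "B = {z. Re z > hi} \<union> lobe (int k)"
  \<comment> \<open>Measuring height from the upper or lower envelope of the line and the wave makes
    \<open>P\<close> and \<open>N\<close> continuous images of connected products.\<close>
  have U: "P = (\<lambda>(x, t). Complex x (max 0 (wave x) + t)) ` (UNIV \<times> {0<..})"
  proof -
    have "z \<in> (\<lambda>(x, t). Complex x (max 0 (wave x) + t)) ` (UNIV \<times> {0<..})"
      if "Im z > max 0 (wave (Re z))" for z
      using that by (intro image_eqI[of _ _ "(Re z, Im z - max 0 (wave (Re z)))"]) (auto simp: complex_eq_iff)
    then show ?thesis by (auto simp: P_def)
  qed
  have L: "N = (\<lambda>(x, t). Complex x (min 0 (wave x) - t)) ` (UNIV \<times> {0<..})"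
  proof -
    have "z \<in> (\<lambda>(x, t). Complex x (min 0 (wave x) - t)) ` (UNIV \<times> {0<..})"
      if "Im z < min 0 (wave (Re z))" for z
      using that by (intro image_eqI[of _ _ "(Re z, min 0 (wave (Re z)) - Im z)"]) (auto simp: complex_eq_iff)
    then show ?thesis by (auto simp: N_def)
  qed
  have cU: "connected P" and cL: "connected N"
    unfolding U L case_prod_unfold Complex_eq
    by (intro connected_continuous_image connected_Times continuous_intros
        continuous_on_compose2[OF continuous_on_wave[of UNIV]]; auto)+
  have side: "connected (H \<union> lobe j)" if "convex H" "x \<in> {of_int j<..<of_int j + 1}" "\<And>y. Complex x y \<in> H" for H j x
  proof (rule connected_Un)
    have "Complex x (1/2 * wave x) \<in> H \<inter> lobe j"
      using that by (auto simp: lobe_def band_iff intro!: bexI[of _ "1/2"])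
    then show "H \<inter> lobe j \<noteq> {}" by blast
  qed (use lobe_props convex_connected that in auto)
  \<comment> \<open>The abscissae \<open>-3/4\<close> and \<open>k + 3/4\<close> lie in the outer
    halves of the extreme lobes, beyond \<open>lo\<close> and \<open>hi\<close>.\<close>
  have cl: "connected A"
    unfolding A_def by (rule side[of _ "-3/4"]) (auto simp: convex_halfspace_Re_lt lo_def)
  have cr: "connected B"
    unfolding B_def by (rule side[of _ "k + 3/4"]) (auto simp: convex_halfspace_Re_gt hi_def)
  have w: "wave (of_int j) = 0" for j
    by (simp add: wave_eq_0_iff)
  \<comment> \<open>The wave vanishes at \<open>-1\<close> and \<open>k + 1\<close>, so heights
    \<open>1\<close> and \<open>-1\<close> are above and below it, and both abscissae lie outside
    the segment.\<close>
  have "Complex (-1) 1 \<in> {z. Im z > max 0 (wave (Re z))} \<inter> ({z. Re z < lo} \<union> lobe (-1))"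
    "Complex (-1) (-1) \<in> {z. Im z < min 0 (wave (Re z))} \<inter> ({z. Re z < lo} \<union> lobe (-1))"
    "Complex (k + 1) 1 \<in> {z. Im z > max 0 (wave (Re z))} \<inter> ({z. Re z > hi} \<union> lobe (int k))"
    using w[of "-1"] w[of "int k + 1"] lo_hi by (auto simp: add.commute)
  then have ne: "P \<inter> A \<noteq> {}" "N \<inter> A \<noteq> {}" "P \<inter> B \<noteq> {}"
    unfolding P_def N_def A_def B_def by blast+
  have "connected (P \<union> A)"
    using cU cl ne(1) by (rule connected_Un)
  then have "connected ((P \<union> A) \<union> N)"
    using cL by (rule connected_Un) (use ne(2) in auto)
  then have "connected (((P \<union> A) \<union> N) \<union> B)"
    using cr by (rule connected_Un) (use ne(3) in auto)
  moreover have "outer = ((P \<union> A) \<union> N) \<union> B"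
    unfolding outer_def P_def N_def A_def B_def by (simp add: Un_ac)
  ultimately show ?thesis by simp
qed

text \<open>Over the segment, a point off the graph is above both curves, below both, or between
  them. In the last case it is in the lobe indexed by the floor of its abscissa, and the extreme
  indices \<open>-1\<close> and \<open>k\<close> belong to \<open>outer\<close>.\<close>

lemma Compl_graph: "- meander_graph \<gamma> lo hi = outer \<union> (\<Union>j\<in>{0..<int k}. lobe j)"
proof -
  have "z \<in> outer \<union> (\<Union>j\<in>{0..<int k}. lobe j)" if "z \<notin> meander_graph \<gamma> lo hi" for z
  proof (cases "Re z < lo \<or> Re z > hi")
    case True
    then show ?thesis by (auto simp: outer_def)
  next
    case False
    show ?thesis
    proof (rule between_cases[where y="Im z" and w="wave (Re z)"])
      assume *: "0 < Im z / wave (Re z)" "Im z / wave (Re z) < 1" "wave (Re z) \<noteq> 0"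
      then have "Re z \<noteq> of_int \<lfloor>Re z\<rfloor>"
        by (metis Ints_of_int wave_eq_0_iff)
      then have "of_int \<lfloor>Re z\<rfloor> < Re z" "Re z < of_int \<lfloor>Re z\<rfloor> + 1"
        by linarith+
      then have "z \<in> lobe \<lfloor>Re z\<rfloor>"
        using * by (simp add: mem_lobe)
      moreover have "-1 \<le> \<lfloor>Re z\<rfloor>" "\<lfloor>Re z\<rfloor> \<le> int k"
        using False lo_hi by linarith+
      then have "\<lfloor>Re z\<rfloor> = -1 \<or> \<lfloor>Re z\<rfloor> = int k \<or> \<lfloor>Re z\<rfloor> \<in> {0..<int k}"
        unfolding atLeastLessThan_iff by linarith
      ultimately show ?thesis
        unfolding outer_def by fastforce
    qed (use that False in \<open>auto simp: outer_def graph_eq\<close>)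
  qed
  \<comment> \<open>On the graph the relative height is \<open>0\<close> or \<open>1\<close>; where
    the wave vanishes it is \<open>0\<close> because division by zero yields
    \<open>0\<close>.\<close>
  moreover have "z \<notin> lobe j" if "Im z = 0 \<or> Im z = wave (Re z)" for z j
    using that by (auto simp: mem_lobe split: if_splits)
  then have "z \<notin> outer \<union> (\<Union>j\<in>{0..<int k}. lobe j)" if "z \<in> meander_graph \<gamma> lo hi" for z
    using that by (auto simp: outer_def graph_eq)
  ultimately show ?thesis by blast
qed

lemma outer_disjoint:
  assumes "0 \<le> j" "j < int k"
  shows "outer \<inter> lobe j = {}"
proof -
  have "z \<notin> outer" if z: "z \<in> lobe j" for z
  proof -
    have m: "of_int j < Re z" "Re z < of_int j + 1" "0 < Im z / wave (Re z)" "Im z / wave (Re z) < 1"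
      using z by (auto simp: mem_lobe)
    have "z \<notin> lobe (-1)" "z \<notin> lobe (int k)"
      using z lobe_unique assms by fastforce+
    moreover have "of_int j + 1 \<le> real k"
      using assms by linarith
    then have "lo \<le> Re z" "Re z \<le> hi"
      using m assms lo_hi by auto
    moreover have "\<not> Im z > max 0 (wave (Re z))" "\<not> Im z < min 0 (wave (Re z))"
      using m(3,4) by (cases "wave (Re z)" "0::real" rule: linorder_cases; simp add: field_simps)+
    ultimately show ?thesis
      by (auto simp: outer_def)
  qed
  then show ?thesis by blast
qed

lemma regions_eq: "regions \<gamma> lo hi = insert outer (lobe ` {0..<int k})"
  unfolding regions_def
proof (rule components_open_unique)
  show "pairwise disjnt (insert outer (lobe ` {0..<int k}))"
  proof -
    have "disjnt outer R \<and> disjnt R outer" if R: "R \<in> lobe ` {0..<int k}" for R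
    proof -
      obtain j where "0 \<le> j" "j < int k" "R = lobe j"
        using R by auto
      then show ?thesis
        using outer_disjoint[of j] unfolding disjnt_def by blast
    qed
    moreover have "pairwise disjnt (lobe ` {0..<int k})"
    proof (rule pairwiseI)
      fix R S assume "R \<in> lobe ` {0..<int k}" "S \<in> lobe ` {0..<int k}" "R \<noteq> S"
      then show "disjnt R S"
        using lobe_unique unfolding disjnt_iff by blast
    qed
    ultimately show ?thesis
      by (simp add: pairwise_insert)
  qed
  show "\<Union> (insert outer (lobe ` {0..<int k})) = - meander_graph \<gamma> lo hi"
    unfolding Compl_graph by auto
  have "outer \<noteq> {}"
    using lobe_props(3) by (auto simp: outer_def)
  then show "\<And>R. R \<in> insert outer (lobe ` {0..<int k}) \<Longrightarrow> open R \<and> connected R \<and> R \<noteq> {}"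
    using lobe_props open_outer connected_outer by auto
qed

section \<open>Orders of the regions of the sine meander\<close>

text \<open>The edge is a limit of the bands inside \<open>R\<close> as the relative height tends to
  \<open>c\<close>, and being part of the graph it avoids the open set \<open>R\<close>.\<close>

lemma edge_in_frontier:
  assumes "open R" "R \<subseteq> - meander_graph \<gamma> lo hi" "band wave (cell j) Y \<subseteq> R" "c \<in> closure Y" "c \<in> {0, 1}"
  shows "band wave (cell j) {c} \<subseteq> frontier R"
proof -
  have "band wave (cell j) {c} \<subseteq> band wave (cell j) (closure Y)"
    using assms(4) by (fastforce simp: band_iff)
  also have "\<dots> \<subseteq> closure R"
    using band_closure_subset closure_mono[OF assms(3)] by blast
  finally have "band wave (cell j) {c} \<subseteq> closure R" .
  moreover have "band wave (cell j) {c} \<subseteq> meander_graph \<gamma> lo hi"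
  proof
    fix z assume "z \<in> band wave (cell j) {c}"
    then have "Re z \<in> cell j" "Im z = c * wave (Re z)"
      by (auto simp: mem_edge)
    then show "z \<in> meander_graph \<gamma> lo hi"
      using assms(5) by (auto simp: graph_eq cell_def)
  qed
  ultimately show ?thesis
    using assms(1,2) by (auto simp: frontier_def interior_open)
qed

lemma order_outer: "region_order \<gamma> lo hi outer = of_nat k"
proof -
  have sub: "outer \<subseteq> - meander_graph \<gamma> lo hi"
    unfolding Compl_graph by blast
  \<comment> \<open>Relative heights below \<open>0\<close> or above \<open>1\<close> mean lying
    outside the gap between the two curves. Both \<open>0\<close> and \<open>1\<close> are limits of
    such heights, so every edge borders \<open>outer\<close>, including those at the
    anchors.\<close>
  have out: "band wave (cell j) ({..<0} \<union> {1<..}) \<subseteq> outer" for j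
  proof
    fix z assume "z \<in> band wave (cell j) ({..<0} \<union> {1<..})"
    then have "wave (Re z) \<noteq> 0" "Im z / wave (Re z) < 0 \<or> Im z / wave (Re z) > 1"
      using mem_band[of "cell j" wave z "{..<0} \<union> {1<..}"] wave_nz_cell by auto
    then have "Im z > max 0 (wave (Re z)) \<or> Im z < min 0 (wave (Re z))"
      by (cases "wave (Re z)" "0::real" rule: linorder_cases) (auto simp: field_simps)
    then show "z \<in> outer"
      by (auto simp: outer_def)
  qed
  have "e \<subseteq> frontier outer" if e: "e \<in> edge_set" for e
  proof -
    obtain j c where "c \<in> {0, 1}" "e = band wave (cell j) {c}"
      using e by (metis edge_setE)
    then show ?thesis
      using edge_in_frontier[OF open_outer sub out, of c j] by auto
  qed
  then have "{e \<in> edge_set. e \<subseteq> frontier outer} = edge_set"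
    by blast
  then show ?thesis
    by (simp add: region_order_def num_sides_def edges_eq card_edge_set field_simps)
qed

lemma order_lobe:
  assumes j: "0 \<le> j" "j < int k"
  shows "region_order \<gamma> lo hi (lobe j) = -1"
proof -
  have sub: "lobe j \<subseteq> - meander_graph \<gamma> lo hi"
    unfolding Compl_graph using j by auto
  have inn: "band wave (cell j) {0<..<1} \<subseteq> lobe j"
    unfolding lobe_def cell_inner[OF j] ..
  have fr: "band wave (cell j) {c} \<subseteq> frontier (lobe j)" if "c \<in> {0, 1}" for c
    using edge_in_frontier[OF lobe_props(1) sub inn, of c] that by auto
  have "i = j" if i: "i \<in> {-1..int k}" and s: "band wave (cell i) {c} \<subseteq> frontier (lobe j)" for i c
  proof -
    obtain z where z: "z \<in> band wave (cell i) {c}"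
      using edge_nonempty[OF i] by blast
    \<comment> \<open>The closed lobe stays over a closed unit interval, which contains no point of
      a cell with another index. Only the two edges over cell \<open>j\<close> remain, and the lobe
      is a bigon.\<close>
    have "closure (lobe j) \<subseteq> {z. of_int j \<le> Re z \<and> Re z \<le> of_int j + 1}"
      by (rule closure_minimal)
        (auto simp: mem_lobe intro!: closed_Collect_conj closed_Collect_le continuous_intros)
    then have "of_int j \<le> Re z" "Re z \<le> of_int j + 1"
      using z s by (auto simp: frontier_def)
    moreover have "of_int i < Re z" "Re z < of_int i + 1"
      using z[unfolded mem_edge] by (auto simp: cell_def)
    ultimately show ?thesis
      by linarith
  qed
  moreover have "j \<in> {-1..int k}"
    using j by auto
  ultimately have "{e \<in> edge_set. e \<subseteq> frontier (lobe j)} = {band wave (cell j) {0}, band wave (cell j) {1}}"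
    using fr unfolding edge_set_def by (auto simp: image_iff) blast+
  moreover have "band wave (cell j) {0} \<noteq> band wave (cell j) {1}"
    using edge_nonempty[OF \<open>j \<in> {-1..int k}\<close>, of 0] edge_unique(2)[of _ j 0 j 1] by fastforce
  ultimately show ?thesis
    by (simp add: region_order_def num_sides_def edges_eq)
qed

text \<open>The \<open>k\<close> lobes and the four anchors supply the \<open>k + 4\<close> entries
  \<open>-1\<close>, and \<open>outer\<close> supplies \<open>k\<close>. There are no further
  regions, so the number of extra zeros is \<open>0\<close>.\<close>

lemma stratum: "in_stratum \<gamma> lo hi (add_mset (int k) (replicate_mset (k + 4) (-1)))"
proof -
  let ?L = "lobe ` {0..<int k}"
  have "inj_on lobe {0..<int k}"
    using lobe_props(3) lobe_unique by (metis all_not_in_conv inj_onI)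
  then have "card ?L = k"
    by (simp add: card_image)
  have "outer \<notin> ?L"
    using outer_disjoint lobe_props(3) by fastforce
  then have "image_mset (region_order \<gamma> lo hi) (mset_set (regions \<gamma> lo hi))
      = add_mset (of_nat k) (image_mset (region_order \<gamma> lo hi) (mset_set ?L))"
    by (simp add: regions_eq order_outer)
  also have "image_mset (region_order \<gamma> lo hi) (mset_set ?L) = image_mset (\<lambda>_. -1) (mset_set ?L)"
    by (rule image_mset_cong) (auto simp: order_lobe)
  finally have "meander_orders \<gamma> lo hi = add_mset (of_nat k) (replicate_mset (k + 4) (-1))"
    using \<open>card ?L = k\<close> card_anchors
    by (simp add: meander_orders_def image_mset_const_eq numeral_eq_Suc)
  then show ?thesis
    unfolding in_stratum_def by (intro exI[of _ 0]) simp
qed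

end

theorem proposition4p5:
  fixes k :: nat
  shows "(\<exists>\<gamma> a b. doubly_anchored_open_meander \<gamma> a b \<and>
            in_stratum \<gamma> a b (add_mset (int k) (replicate_mset (k + 4) (-1))) \<and>
            card (crossings \<gamma>) = k + 1) \<and>
         (\<forall>\<gamma> a b. doubly_anchored_open_meander \<gamma> a b \<and>
            in_stratum \<gamma> a b (add_mset (int k) (replicate_mset (k + 4) (-1))) \<longrightarrow>
            k + 1 \<le> card (crossings \<gamma>))"
  using sine_meander.doubly_anchored sine_meander.stratum sine_meander.card_crossings card_crossings_ge
  by blast

end
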